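(* Let $S$ be a pomonoid and let $f:A_S\to B_S$ be an $S$-poset map between right $S$-posets. Suppose $f$ is an Emb-injective object in the slice category $\mathbf{Pos}\text{-}S/B_S$ and $A_S$ is a cyclic projective $S$-poset. Then $B_S$ is a cyclic projective $S$-poset. Moreover, ${}_{\mathrm{End}(B_S)}B$ is a generator in $\mathrm{End}(B_S)\text{-}\mathbf{Pos}$.
   Context: A pomonoid is a monoid $S$ with a partial order $\leq$ such that $s\leq t$ and $s'\leq t'$ imply $ss'\leq tt'$. A (right) $S$-poset is a poset $A$ with a right monoid action $A\times S\to A$ that is order-preserving for the componentwise order on $A\times S$. $\mathbf{Pos}\text{-}S$ is the category of right $S$-posets with monotone action-preserving maps ($S$-poset maps); for a pomonoid $T$, $T\text{-}\mathbf{Pos}$ is the analogous category of left $T$-posets. An object $G$ is a generator if for any two distinct morphisms $\alpha,\beta:X\to Y$ there is a morphism $g:G\to X$ with $\alpha g\neq\beta g$. Projective means projective with respect to epimorphisms, which are exactly the surjective morphisms; a right $S$-poset $A$ is cyclic if $A=aS$ for some $a\in A$; cyclic projective means cyclic and projective. $\mathrm{End}(B_S)$ is the pomonoid of all $S$-poset maps $B_S\to B_S$ under composition with pointwise order, and ${}_{\mathrm{End}(B_S)}B$ is $B$ with the left action $h\cdot b=h(b)$. Objects of $\mathbf{Pos}\text{-}S/B_S$ are $S$-poset maps with codomain $B_S$; morphisms from $p:D\to B_S$ to $q:E\to B_S$ are $S$-poset maps $h:D\to E$ with $qh=p$. Emb is the class of order-embeddings ($S$-poset maps $h$ with $h(x)\leq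 h(y)\iff x\leq y$). An object $f:A_S\to B_S$ is Emb-injective in $\mathbf{Pos}\text{-}S/B_S$ if for every order-embedding $h:U\to V$ of $S$-posets and $S$-poset maps $u:U\to A_S$, $v:V\to B_S$ with $fu=vh$, there is an $S$-poset map $s:V\to A_S$ with $sh=u$ and $fs=v$. *)

theory Defs
  imports "HOL-Algebra.Group" "HOL-Library.FuncSet"
begin

text \<open>
  All structures are carrier-based. Morphisms are extensional functions (the value outside
  the carrier of the domain is \<^const>\<open>undefined\<close>), so that equality of morphisms is equality
  of HOL functions, hom-sets are genuine sets of morphisms, and composition is
  \<^const>\<open>compose\<close>. The empty poset is allowed as a carrier.

  HOL cannot quantify over types inside a formula. Notions that quantify over all objects of
  a category therefore take a type token: their test objects are all objects
  carried by a subset of that type. As a hypothesis, such a notion at one fixed type is implied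
  by the unrestricted notion; as a conclusion, at a free type variable, it says that the notion
  holds for test objects on every type.
\<close>

definition poset_on :: "'a set \<Rightarrow> ('a \<Rightarrow> 'a \<Rightarrow> bool) \<Rightarrow> bool" where
  "poset_on A r \<longleftrightarrow> reflp_on A r \<and> transp_on A r \<and> antisymp_on A r"

record 's pomonoid = "'s monoid" +
  mle :: "'s \<Rightarrow> 's \<Rightarrow> bool"

locale pomonoid = monoid S for S :: "'s pomonoid" (structure) +
  assumes poset: "poset_on (carrier S) (mle S)"
    and mult_mono:
      "\<lbrakk>s \<in> carrier S; t \<in> carrier S; s' \<in> carrier S; t' \<in> carrier S; mle S s t; mle S s' t'\<rbrakk>
        \<Longrightarrow> mle S (s \<otimes> s') (t \<otimes> t')"

record ('a, 's) right_poset = "'a partial_object" +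
  rle :: "'a \<Rightarrow> 'a \<Rightarrow> bool"
  ract :: "'a \<Rightarrow> 's \<Rightarrow> 'a"

locale right_sposet = pomonoid S
  for S :: "'s pomonoid" (structure) and A :: "('a, 's) right_poset" +
  assumes poset_A: "poset_on (carrier A) (rle A)"
    and ract_closed: "\<lbrakk>a \<in> carrier A; s \<in> carrier S\<rbrakk> \<Longrightarrow> ract A a s \<in> carrier A"
    and ract_one: "a \<in> carrier A \<Longrightarrow> ract A a \<one> = a"
    and ract_mult: "\<lbrakk>a \<in> carrier A; s \<in> carrier S; t \<in> carrier S\<rbrakk>
      \<Longrightarrow> ract A a (s \<otimes> t) = ract A (ract A a s) t"
    and ract_mono: "\<lbrakk>a \<in> carrier A; b \<in> carrier A; s \<in> carrier S; t \<in> carrier S;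
      rle A a b; mle S s t\<rbrakk> \<Longrightarrow> rle A (ract A a s) (ract A b t)"

record ('a, 't) left_poset = "'a partial_object" +
  lle :: "'a \<Rightarrow> 'a \<Rightarrow> bool"
  lact :: "'t \<Rightarrow> 'a \<Rightarrow> 'a"

locale left_tposet = pomonoid T
  for T :: "'t pomonoid" (structure) and A :: "('a, 't) left_poset" +
  assumes poset_A: "poset_on (carrier A) (lle A)"
    and lact_closed: "\<lbrakk>t \<in> carrier T; a \<in> carrier A\<rbrakk> \<Longrightarrow> lact A t a \<in> carrier A"
    and lact_one: "a \<in> carrier A \<Longrightarrow> lact A \<one> a = a"
    and lact_mult: "\<lbrakk>s \<in> carrier T; t \<in> carrier T; a \<in> carrier A\<rbrakk>
      \<Longrightarrow> lact A (s \<otimes> t) a = lact A s (lact A t a)"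
    and lact_mono: "\<lbrakk>s \<in> carrier T; t \<in> carrier T; a \<in> carrier A; b \<in> carrier A;
      mle T s t; lle A a b\<rbrakk> \<Longrightarrow> lle A (lact A s a) (lact A t b)"

definition right_hom ::
    "'s pomonoid \<Rightarrow> ('a, 's) right_poset \<Rightarrow> ('b, 's) right_poset \<Rightarrow> ('a \<Rightarrow> 'b) set" where
  "right_hom S A B = {h \<in> carrier A \<rightarrow>\<^sub>E carrier B.
     (\<forall>x\<in>carrier A. \<forall>y\<in>carrier A. rle A x y \<longrightarrow> rle B (h x) (h y)) \<and>
     (\<forall>x\<in>carrier A. \<forall>s\<in>carrier S. h (ract A x s) = ract B (h x) s)}"

definition left_hom ::
    "'t pomonoid \<Rightarrow> ('a, 't) left_poset \<Rightarrow> ('b, 't) left_poset \<Rightarrow> ('a \<Rightarrow> 'b) set" where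
  "left_hom T A B = {h \<in> carrier A \<rightarrow>\<^sub>E carrier B.
     (\<forall>x\<in>carrier A. \<forall>y\<in>carrier A. lle A x y \<longrightarrow> lle B (h x) (h y)) \<and>
     (\<forall>t\<in>carrier T. \<forall>x\<in>carrier A. h (lact A t x) = lact B t (h x))}"

definition right_emb ::
    "'s pomonoid \<Rightarrow> ('a, 's) right_poset \<Rightarrow> ('b, 's) right_poset \<Rightarrow> ('a \<Rightarrow> 'b) set" where
  "right_emb S A B = {h \<in> right_hom S A B.
     \<forall>x\<in>carrier A. \<forall>y\<in>carrier A. rle B (h x) (h y) \<longleftrightarrow> rle A x y}"

text \<open>Emb-injectivity of the object \<open>f : A \<rightarrow> B\<close> of the slice category over \<open>B\<close>.\<close>

definition slice_emb_injective ::
    "'u itself \<Rightarrow> 's pomonoid \<Rightarrow> ('a, 's) right_poset \<Rightarrow> ('b, 's) right_poset \<Rightarrow> ('a \<Rightarrow> 'b) \<Rightarrow> bool"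
  where
  "slice_emb_injective (ty :: 'u itself) S A B f \<longleftrightarrow>
     f \<in> right_hom S A B \<and>
     (\<forall>(U :: ('u, 's) right_poset) (V :: ('u, 's) right_poset) h u v.
        right_sposet S U \<longrightarrow> right_sposet S V \<longrightarrow> h \<in> right_emb S U V \<longrightarrow>
        u \<in> right_hom S U A \<longrightarrow> v \<in> right_hom S V B \<longrightarrow>
        compose (carrier U) f u = compose (carrier U) v h \<longrightarrow>
        (\<exists>s\<in>right_hom S V A. compose (carrier U) s h = u \<and> compose (carrier V) f s = v))"

definition cyclic :: "'s pomonoid \<Rightarrow> ('a, 's) right_poset \<Rightarrow> bool" where
  "cyclic S A \<longleftrightarrow> (\<exists>a\<in>carrier A. carrier A = {ract A a s |s. s \<in> carrier S})"

text \<open>The epimorphisms of S-posets are exactly the surjective S-poset maps.\<close>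

definition projective :: "'u itself \<Rightarrow> 's pomonoid \<Rightarrow> ('a, 's) right_poset \<Rightarrow> bool" where
  "projective (ty :: 'u itself) S P \<longleftrightarrow>
     (\<forall>(X :: ('u, 's) right_poset) (Y :: ('u, 's) right_poset) e k.
        right_sposet S X \<longrightarrow> right_sposet S Y \<longrightarrow>
        e \<in> right_hom S X Y \<longrightarrow> e ` carrier X = carrier Y \<longrightarrow> k \<in> right_hom S P Y \<longrightarrow>
        (\<exists>l\<in>right_hom S P X. compose (carrier P) e l = k))"

definition left_generator :: "'u itself \<Rightarrow> 't pomonoid \<Rightarrow> ('a, 't) left_poset \<Rightarrow> bool" where
  "left_generator (ty :: 'u itself) T G \<longleftrightarrow>
     left_tposet T G \<and>
     (\<forall>(X :: ('u, 't) left_poset) (Y :: ('u, 't) left_poset) \<alpha> \<beta>.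
        left_tposet T X \<longrightarrow> left_tposet T Y \<longrightarrow>
        \<alpha> \<in> left_hom T X Y \<longrightarrow> \<beta> \<in> left_hom T X Y \<longrightarrow> \<alpha> \<noteq> \<beta> \<longrightarrow>
        (\<exists>g\<in>left_hom T G X. compose (carrier G) \<alpha> g \<noteq> compose (carrier G) \<beta> g))"

definition End_pomonoid :: "'s pomonoid \<Rightarrow> ('b, 's) right_poset \<Rightarrow> ('b \<Rightarrow> 'b) pomonoid" where
  "End_pomonoid S B =
     \<lparr>carrier = right_hom S B B,
      mult = compose (carrier B),
      one = (\<lambda>x\<in>carrier B. x),
      mle = (\<lambda>g h. \<forall>x\<in>carrier B. rle B (g x) (h x))\<rparr>"

definition End_left :: "('b, 's) right_poset \<Rightarrow> ('b, 'b \<Rightarrow> 'b) left_poset" where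
  "End_left B = \<lparr>carrier = carrier B, lle = rle B, lact = (\<lambda>h b. h b)\<rparr>"

end

theory Submission
  imports Defs
begin

text \<open>
  Lifting the identity of \<open>B\<close> against the embedding of the empty S-poset shows that an
  Emb-injective \<open>f\<close> is a split epimorphism, and projectivity splits \<open>s \<mapsto> a s\<close> for a
  generator \<open>a\<close> of \<open>A\<close>. Composing the two sections and putting \<open>b = f a\<close> gives an S-poset map
  \<open>\<sigma> : B \<rightarrow> S\<close> with \<open>b \<sigma>(c) = c\<close> for all \<open>c\<close>. Everything follows from \<open>\<sigma>\<close>: \<open>b\<close> generates \<open>B\<close>;
  a map \<open>k : B \<rightarrow> Y\<close> lifts along a surjection \<open>e\<close> to \<open>c \<mapsto> x \<sigma>(c)\<close> whenever \<open>e x = k b\<close>; and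
  \<open>d \<mapsto> (c \<mapsto> d \<sigma>(c))\<close> is a left \<open>End(B)\<close>-map \<open>B \<rightarrow> End(B)\<close> sending \<open>b\<close> to the identity, so that
  every element of a left \<open>End(B)\<close>-poset is the image of \<open>b\<close> under some morphism from \<open>B\<close>.
\<close>

section \<open>Rules for orders and morphisms; composites and identities of S-poset maps\<close>

lemma poset_onD:
  assumes "poset_on A r"
  shows "x \<in> A \<Longrightarrow> r x x"
    and "\<lbrakk>x \<in> A; y \<in> A; z \<in> A; r x y; r y z\<rbrakk> \<Longrightarrow> r x z"
    and "\<lbrakk>x \<in> A; y \<in> A; r x y; r y x\<rbrakk> \<Longrightarrow> x = y"
  using assms unfolding poset_on_def
  by (auto dest: reflp_onD transp_onD antisymp_onD)

lemma poset_onI: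
  assumes "\<And>x. x \<in> A \<Longrightarrow> r x x"
    and "\<And>x y z. \<lbrakk>x \<in> A; y \<in> A; z \<in> A; r x y; r y z\<rbrakk> \<Longrightarrow> r x z"
    and "\<And>x y. \<lbrakk>x \<in> A; y \<in> A; r x y; r y x\<rbrakk> \<Longrightarrow> x = y"
  shows "poset_on A r"
  using assms unfolding poset_on_def
  by (intro conjI reflp_onI transp_onI antisymp_onI) blast+

lemma right_homD:
  assumes "h \<in> right_hom S A B"
  shows "x \<in> carrier A \<Longrightarrow> h x \<in> carrier B"
    and "\<lbrakk>x \<in> carrier A; y \<in> carrier A; rle A x y\<rbrakk> \<Longrightarrow> rle B (h x) (h y)"
    and "\<lbrakk>x \<in> carrier A; s \<in> carrier S\<rbrakk> \<Longrightarrow> h (ract A x s) = ract B (h x) s"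
    and "h \<in> extensional (carrier A)"
  using assms unfolding right_hom_def by (auto simp: PiE_def)

lemma right_homI:
  assumes "\<And>x. x \<in> carrier A \<Longrightarrow> h x \<in> carrier B"
    and "\<And>x y. \<lbrakk>x \<in> carrier A; y \<in> carrier A; rle A x y\<rbrakk> \<Longrightarrow> rle B (h x) (h y)"
    and "\<And>x s. \<lbrakk>x \<in> carrier A; s \<in> carrier S\<rbrakk> \<Longrightarrow> h (ract A x s) = ract B (h x) s"
    and "h \<in> extensional (carrier A)"
  shows "h \<in> right_hom S A B"
  using assms unfolding right_hom_def by (auto simp: PiE_def)

lemma left_homD:
  assumes "h \<in> left_hom T A B"
  shows "x \<in> carrier A \<Longrightarrow> h x \<in> carrier B"
    and "h \<in> extensional (carrier A)"
  using assms unfolding left_hom_def by (auto simp: PiE_def)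

lemma right_hom_compose:
  assumes "right_sposet S A" "g \<in> right_hom S A B" "h \<in> right_hom S B C"
  shows "compose (carrier A) h g \<in> right_hom S A C"
  by (rule right_homI)
    (use assms(1) right_homD[OF assms(2)] right_homD[OF assms(3)] in
      \<open>auto simp: compose_eq right_sposet.ract_closed\<close>)

lemma right_hom_id:
  assumes "right_sposet S A"
  shows "(\<lambda>x\<in>carrier A. x) \<in> right_hom S A A"
  by (rule right_homI) (use assms in \<open>auto simp: right_sposet.ract_closed\<close>)

section \<open>The regular S-poset and maps that factor through it\<close>

definition right_regular :: "'s pomonoid \<Rightarrow> ('s, 's) right_poset" where
  "right_regular S = \<lparr>carrier = carrier S, rle = mle S, ract = mult S\<rparr>"

lemma right_regular_simps [simp]:
  "carrier (right_regular S) = carrier S"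
  "rle (right_regular S) = mle S"
  "ract (right_regular S) = mult S"
  by (simp_all add: right_regular_def)

lemma right_sposet_regular:
  assumes "pomonoid S"
  shows "right_sposet S (right_regular S)"
proof -
  interpret pomonoid S by fact
  show ?thesis
    by unfold_locales (auto simp: poset m_assoc intro: mult_mono)
qed

context right_sposet
begin

text \<open>The map is \<open>h\<close> followed by the orbit map s \<mapsto> a s; joint
  monotonicity of the action, with reflexivity at \<open>a\<close>, makes the latter monotone.
  Taking the identity for \<open>h\<close> yields the cover of a cyclic S-poset by S; taking
  \<sigma> yields both the lifts out of \<open>B\<close> and the endomorphisms
  \<open>to_End d\<close>.\<close>

lemma orbit_hom:
  assumes a: "a \<in> carrier A" and h: "h \<in> right_hom S P (right_regular S)"
    and P: "right_sposet S P"
  shows "(\<lambda>c\<in>carrier P. ract A a (h c)) \<in> right_hom S P A"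
proof (rule right_homI)
  fix x y assume "x \<in> carrier P" "y \<in> carrier P" "rle P x y"
  then show "rle A ((\<lambda>c\<in>carrier P. ract A a (h c)) x) ((\<lambda>c\<in>carrier P. ract A a (h c)) y)"
    using right_homD(1,2)[OF h] a by (auto intro!: ract_mono poset_onD(1)[OF poset_A])
next
  fix x s assume "x \<in> carrier P" "s \<in> carrier S"
  then show "(\<lambda>c\<in>carrier P. ract A a (h c)) (ract P x s)
      = ract A ((\<lambda>c\<in>carrier P. ract A a (h c)) x) s"
    using right_homD(1,3)[OF h] a right_sposet.ract_closed[OF P] by (simp add: ract_mult)
qed (use a right_homD(1)[OF h] in \<open>auto intro: ract_closed\<close>)

end

text \<open>
  The hypotheses only speak about test objects carried by one fixed type; isomorphic copies
  along injections make them applicable to objects carried by other types.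
\<close>

definition right_copy :: "('a \<Rightarrow> 'u) \<Rightarrow> ('a, 's) right_poset \<Rightarrow> ('u, 's) right_poset" where
  "right_copy i A = \<lparr>carrier = i ` carrier A,
     rle = (\<lambda>x y. rle A (inv_into UNIV i x) (inv_into UNIV i y)),
     ract = (\<lambda>x s. i (ract A (inv_into UNIV i x) s))\<rparr>"

lemma right_copy_simps [simp]:
  "carrier (right_copy i A) = i ` carrier A"
  "rle (right_copy i A) = (\<lambda>x y. rle A (inv_into UNIV i x) (inv_into UNIV i y))"
  "ract (right_copy i A) = (\<lambda>x s. i (ract A (inv_into UNIV i x) s))"
  by (simp_all add: right_copy_def)

lemma right_sposet_copy:
  assumes "right_sposet S A" "inj i"
  shows "right_sposet S (right_copy i A)"
proof -
  interpret right_sposet S A by fact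
  note P = poset_onD[OF poset_A]
  let ?r = "inv_into UNIV i"
  show ?thesis
  proof
    show "poset_on (carrier (right_copy i A)) (rle (right_copy i A))"
    proof (rule poset_onI)
      fix x y z assume "x \<in> carrier (right_copy i A)" "y \<in> carrier (right_copy i A)"
        "z \<in> carrier (right_copy i A)" "rle (right_copy i A) x y" "rle (right_copy i A) y z"
      then show "rle (right_copy i A) x z"
        using P(2)[of "?r x" "?r y" "?r z"] assms(2) by auto
    next
      fix x y assume "x \<in> carrier (right_copy i A)" "y \<in> carrier (right_copy i A)"
        "rle (right_copy i A) x y" "rle (right_copy i A) y x"
      then show "x = y"
        using P(3)[of "?r x" "?r y"] assms(2) by auto
    qed (use assms(2) P(1) in auto)
  qed (use assms(2) in \<open>auto simp: ract_closed ract_one ract_mult ract_mono\<close>)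
qed

lemma right_copy_in:
  assumes "right_sposet S A" "inj i"
  shows "(\<lambda>x\<in>carrier A. i x) \<in> right_hom S A (right_copy i A)"
  by (rule right_homI) (use assms in \<open>auto simp: right_sposet.ract_closed\<close>)

lemma right_copy_out:
  assumes "right_sposet S A" "inj i"
  shows "(\<lambda>x\<in>i ` carrier A. inv_into UNIV i x) \<in> right_hom S (right_copy i A) A"
  by (rule right_homI) (use assms in \<open>auto simp: right_sposet.ract_closed\<close>)

text \<open>The lifting problem is moved to copies of \<open>X\<close> and \<open>Y\<close> on the
  type of the token, solved there, and the lift is brought back along the inverse of
  \<open>i\<close>. Separate injections let \<open>X\<close> and \<open>Y\<close> live on different
  types.\<close>

lemma projective_lift:
  fixes X :: "('x, 's) right_poset" and Y :: "('y, 's) right_poset"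
    and i :: "'x \<Rightarrow> 'u" and j :: "'y \<Rightarrow> 'u"
  assumes proj: "projective TYPE('u) S P" and i: "inj i" and j: "inj j"
    and P: "right_sposet S P" and X: "right_sposet S X" and Y: "right_sposet S Y"
    and e: "e \<in> right_hom S X Y" and surj: "e ` carrier X = carrier Y"
    and k: "k \<in> right_hom S P Y"
  obtains l where "l \<in> right_hom S P X" "\<And>c. c \<in> carrier P \<Longrightarrow> e (l c) = k c"
proof -
  let ?X = "right_copy i X" and ?Y = "right_copy j Y"
  let ?out = "\<lambda>x\<in>i ` carrier X. inv_into UNIV i x" and ?in = "\<lambda>y\<in>carrier Y. j y"
  \<comment> \<open>\<open>e'\<close> leaves the copy of \<open>X\<close>, applies \<open>e\<close>
    and enters the copy of \<open>Y\<close>. \<open>P\<close> itself is not copied, since the token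
    constrains only the test objects.\<close>
  define e' where "e' = compose (carrier ?X) ?in (compose (carrier ?X) e ?out)"
  define k' where "k' = compose (carrier P) ?in k"
  note X' = right_sposet_copy[OF X i]
  have e': "e' \<in> right_hom S ?X ?Y"
    unfolding e'_def
    by (intro right_hom_compose[OF X' right_hom_compose[OF X' right_copy_out[OF X i] e]]
        right_copy_in Y j)
  have k': "k' \<in> right_hom S P ?Y"
    unfolding k'_def by (rule right_hom_compose[OF P k right_copy_in[OF Y j]])
  have e'_eq: "e' (i x) = j (e x)" if "x \<in> carrier X" for x
    using that i right_homD(1)[OF e] by (simp add: e'_def compose_def)
  have "e' ` carrier ?X = carrier ?Y"
    using e'_eq surj by (force simp: image_iff)
  then obtain l where l: "l \<in> right_hom S P ?X" and lk: "compose (carrier P) e' l = k'"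
    using proj X' right_sposet_copy[OF Y j] e' k' unfolding projective_def by blast
  show thesis
  proof
    show "compose (carrier P) ?out l \<in> right_hom S P X"
      by (rule right_hom_compose[OF P l right_copy_out[OF X i]])
    fix c assume c: "c \<in> carrier P"
    then obtain x where x: "x \<in> carrier X" "l c = i x"
      using right_homD(1)[OF l] by fastforce
    have "j (e x) = e' (l c)" using x e'_eq by simp
    also have "\<dots> = j (k c)"
      using fun_cong[OF lk, of c] c right_homD(1)[OF k]
      by (simp add: k'_def compose_eq)
    finally have "e x = k c" using j by (simp add: inj_eq)
    then show "e (compose (carrier P) ?out l c) = k c"
      using c x i by (simp add: compose_eq)
  qed
qed

section \<open>Splittings obtained from injectivity and projectivity\<close>

lemma slice_emb_injective_section:
  fixes B :: "('b, 's) right_poset" and i :: "'b \<Rightarrow> 'u"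
  assumes inj: "slice_emb_injective TYPE('u) S A B f" and i: "inj i"
    and B: "right_sposet S B"
  obtains g where "g \<in> right_hom S B A" "\<And>b. b \<in> carrier B \<Longrightarrow> f (g b) = b"
proof -
  interpret right_sposet S B by fact
  \<comment> \<open>On the empty carrier every order and action will do, so these are
    arbitrary.\<close>
  let ?U = "\<lparr>carrier = {}, rle = (\<lambda>_ _. True), ract = (\<lambda>x _. x)\<rparr> :: ('u, 's) right_poset"
  let ?V = "right_copy i B"
  let ?v = "\<lambda>x\<in>i ` carrier B. inv_into UNIV i x"
  \<comment> \<open>The constant \<open>undefined\<close> is the only extensional function on the
    empty set, so it serves both as the embedding and as the map to \<open>A\<close>.\<close>
  let ?z = "\<lambda>_. undefined"
  have U: "right_sposet S ?U"
    by unfold_locales (auto intro: poset_onI)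
  have "?z \<in> right_emb S ?U ?V" "?z \<in> right_hom S ?U A"
    by (auto simp: right_emb_def right_hom_def)
  moreover have "compose (carrier ?U) f ?z = compose (carrier ?U) ?v ?z"
    by (auto simp: compose_def fun_eq_iff)
  ultimately obtain g where g: "g \<in> right_hom S ?V A" "compose (carrier ?V) f g = ?v"
    using inj U right_sposet_copy[OF B i] right_copy_out[OF B i]
    unfolding slice_emb_injective_def by blast
  show thesis
  proof
    \<comment> \<open>The filler \<open>g\<close> starts at the copy of \<open>B\<close>; entering
      the copy first gives a section of \<open>f\<close> on \<open>B\<close> itself.\<close>
    show "compose (carrier B) g (\<lambda>b\<in>carrier B. i b) \<in> right_hom S B A"
      by (rule right_hom_compose[OF B right_copy_in[OF B i] g(1)])
    fix b assume "b \<in> carrier B"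
    then show "f (compose (carrier B) g (\<lambda>b\<in>carrier B. i b) b) = b"
      using fun_cong[OF g(2), of "i b"] i by (simp add: compose_eq)
  qed
qed

text \<open>For a generator \<open>a\<close>, the orbit map s \<mapsto> a s is a surjection from S
  onto \<open>A\<close>; lifting the identity of \<open>A\<close> along it gives \<tau>. The
  surjection runs between the types \<open>'s\<close> and \<open>'a\<close>, hence two
  injections.\<close>

lemma cyclic_projective_coordinate:
  fixes S :: "'s pomonoid" and A :: "('a, 's) right_poset"
    and i :: "'s \<Rightarrow> 'u" and j :: "'a \<Rightarrow> 'u"
  assumes A: "right_sposet S A" and cyc: "cyclic S A" and proj: "projective TYPE('u) S A"
    and i: "inj i" and j: "inj j"
  obtains a \<tau> where "a \<in> carrier A" "\<tau> \<in> right_hom S A (right_regular S)"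
    "\<And>c. c \<in> carrier A \<Longrightarrow> ract A a (\<tau> c) = c"
proof -
  interpret right_sposet S A by fact
  have R: "right_sposet S (right_regular S)"
    by (rule right_sposet_regular) unfold_locales
  obtain a where a: "a \<in> carrier A" and gen: "carrier A = {ract A a s |s. s \<in> carrier S}"
    using cyc unfolding cyclic_def by blast
  define e where "e = (\<lambda>s\<in>carrier S. ract A a s)"
  have e: "e \<in> right_hom S (right_regular S) A"
    using orbit_hom[OF a right_hom_id[OF R] R] by (simp add: e_def cong: restrict_cong)
  have "e ` carrier (right_regular S) = carrier A"
    unfolding gen by (auto simp: e_def)
  then obtain \<tau> where \<tau>: "\<tau> \<in> right_hom S A (right_regular S)"
      and sec: "\<And>c. c \<in> carrier A \<Longrightarrow> e (\<tau> c) = (\<lambda>x\<in>carrier A. x) c"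
    using projective_lift[OF proj i j A R A e _ right_hom_id[OF A]] by metis
  have "ract A a (\<tau> c) = c" if "c \<in> carrier A" for c
    using sec[OF that] right_homD(1)[OF \<tau> that] that by (simp add: e_def)
  with a \<tau> show thesis by (rule that)
qed

section \<open>Cyclicity and projectivity from a coordinate map\<close>

locale coordinatized = right_sposet S B
  for S :: "'s pomonoid" (structure) and B :: "('b, 's) right_poset" +
  fixes b :: 'b and \<sigma> :: "'b \<Rightarrow> 's"
  assumes b: "b \<in> carrier B" and \<sigma>: "\<sigma> \<in> right_hom S B (right_regular S)"
    and coord: "c \<in> carrier B \<Longrightarrow> ract B b (\<sigma> c) = c"
begin

lemma right_sposet_B: "right_sposet S B"
  by unfold_locales

lemma coord_closed: "c \<in> carrier B \<Longrightarrow> \<sigma> c \<in> carrier S"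
  using right_homD(1)[OF \<sigma>] by simp

lemma cyclic_B: "cyclic S B"
proof -
  have "\<exists>s. c = ract B b s \<and> s \<in> carrier S" if "c \<in> carrier B" for c
    using coord[OF that] coord_closed[OF that] by metis
  then have "carrier B = {ract B b s |s. s \<in> carrier S}"
    using b ract_closed by blast
  with b show ?thesis unfolding cyclic_def by blast
qed

text \<open>A single preimage \<open>x\<close> of \<open>k b\<close> determines the whole lift,
  because e(x \<sigma>(c)) = k(b) \<sigma>(c) = k(b \<sigma>(c)) = k(c).\<close>

lemma projective_B: "projective TYPE('u) S B"
  unfolding projective_def
proof (intro allI impI)
  fix X Y :: "('u, 's) right_poset" and e k
  assume X: "right_sposet S X" and "right_sposet S Y" and e: "e \<in> right_hom S X Y"
    and surj: "e ` carrier X = carrier Y" and k: "k \<in> right_hom S B Y"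
  obtain x where x: "x \<in> carrier X" "e x = k b"
    using surj right_homD(1)[OF k b] by (metis imageE)
  let ?l = "\<lambda>c\<in>carrier B. ract X x (\<sigma> c)"
  have "?l \<in> right_hom S B X"
    by (rule right_sposet.orbit_hom[OF X x(1) \<sigma> right_sposet_B])
  moreover have "e (?l c) = k c" if "c \<in> carrier B" for c
    using that x right_homD(3)[OF e x(1) coord_closed[OF that]]
      right_homD(3)[OF k b coord_closed[OF that]] coord[OF that] by simp
  then have "compose (carrier B) e ?l = k"
    by (intro extensionalityI[OF compose_extensional right_homD(4)[OF k]])
      (simp add: compose_def)
  ultimately show "\<exists>l\<in>right_hom S B X. compose (carrier B) e l = k" by blast
qed

end

section \<open>The endomorphism pomonoid and its left action\<close>

lemma End_simps [simp]:
  "carrier (End_pomonoid S B) = right_hom S B B"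
  "mult (End_pomonoid S B) = compose (carrier B)"
  "one (End_pomonoid S B) = (\<lambda>x\<in>carrier B. x)"
  "mle (End_pomonoid S B) = (\<lambda>g h. \<forall>x\<in>carrier B. rle B (g x) (h x))"
  "carrier (End_left B) = carrier B"
  "lle (End_left B) = rle B"
  "lact (End_left B) = (\<lambda>h b. h b)"
  by (simp_all add: End_pomonoid_def End_left_def)

context right_sposet
begin

lemma End_is_pomonoid: "pomonoid (End_pomonoid S A)"
proof -
  have A: "right_sposet S A" by unfold_locales
  note P = poset_onD[OF poset_A]
  let ?E = "End_pomonoid S A"
  show ?thesis
  proof
    fix f g assume "f \<in> carrier ?E" "g \<in> carrier ?E"
    then show "f \<otimes>\<^bsub>?E\<^esub> g \<in> carrier ?E"
      by (simp add: right_hom_compose[OF A])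
  next
    fix f g h assume H: "f \<in> carrier ?E" "g \<in> carrier ?E" "h \<in> carrier ?E"
    then have h: "h \<in> right_hom S A A" by simp
    show "f \<otimes>\<^bsub>?E\<^esub> g \<otimes>\<^bsub>?E\<^esub> h = f \<otimes>\<^bsub>?E\<^esub> (g \<otimes>\<^bsub>?E\<^esub> h)"
      using right_homD(1)[OF h] by (auto simp: compose_def fun_eq_iff)
  next
    show "\<one>\<^bsub>?E\<^esub> \<in> carrier ?E"
      by (simp add: right_hom_id[OF A])
  next
    fix f assume "f \<in> carrier ?E"
    then have f: "f \<in> right_hom S A A" by simp
    then have "f \<in> carrier A \<rightarrow> carrier A" using right_homD(1)[OF f] by blast
    then show "\<one>\<^bsub>?E\<^esub> \<otimes>\<^bsub>?E\<^esub> f = f" "f \<otimes>\<^bsub>?E\<^esub> \<one>\<^bsub>?E\<^esub> = f"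
      using right_homD(4)[OF f] by (simp_all add: Id_compose compose_Id)
  next
    show "poset_on (carrier ?E) (mle ?E)"
    proof (rule poset_onI)
      fix f assume "f \<in> carrier ?E"
      then have f: "f \<in> right_hom S A A" by simp
      show "mle ?E f f" using P(1) right_homD(1)[OF f] by simp
    next
      fix f g h assume H: "f \<in> carrier ?E" "g \<in> carrier ?E" "h \<in> carrier ?E"
        "mle ?E f g" "mle ?E g h"
      then have f: "f \<in> right_hom S A A" and g: "g \<in> right_hom S A A"
        and h: "h \<in> right_hom S A A" by simp_all
      show "mle ?E f h"
        using H(4,5) P(2)[OF right_homD(1)[OF f] right_homD(1)[OF g] right_homD(1)[OF h]] by simp
    next
      fix f g assume H: "f \<in> carrier ?E" "g \<in> carrier ?E" "mle ?E f g" "mle ?E g f"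
      then have f: "f \<in> right_hom S A A" and g: "g \<in> right_hom S A A" by simp_all
      show "f = g"
        using H(3,4) P(3)[OF right_homD(1)[OF f] right_homD(1)[OF g]]
        by (intro extensionalityI[OF right_homD(4)[OF f] right_homD(4)[OF g]]) simp
    qed
  next
    fix s t s' t'
    assume H: "s \<in> carrier ?E" "t \<in> carrier ?E" "s' \<in> carrier ?E" "t' \<in> carrier ?E"
      "mle ?E s t" "mle ?E s' t'"
    then have s: "s \<in> right_hom S A A" and t: "t \<in> right_hom S A A"
      and s': "s' \<in> right_hom S A A" and t': "t' \<in> right_hom S A A" by simp_all
    have "rle A (s (s' x)) (t (t' x))" if x: "x \<in> carrier A" for x
    proof -
      note x' = right_homD(1)[OF s' x] right_homD(1)[OF t' x]
      \<comment> \<open>The comparison passes through s(t' x): first raise the argument, using that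
        \<open>s\<close> is monotone, then raise the map.\<close>
      have "rle A (s (s' x)) (s (t' x))" "rle A (s (t' x)) (t (t' x))"
        using H(5,6) x x' right_homD(2)[OF s x'] by simp_all
      then show ?thesis
        using P(2) right_homD(1)[OF s x'(1)] right_homD(1)[OF s x'(2)]
          right_homD(1)[OF t x'(2)] by blast
    qed
    then show "mle ?E (s \<otimes>\<^bsub>?E\<^esub> s') (t \<otimes>\<^bsub>?E\<^esub> t')"
      by (simp add: compose_eq)
  qed
qed

lemma End_left_is_left_tposet: "left_tposet (End_pomonoid S A) (End_left A)"
proof -
  interpret E: pomonoid "End_pomonoid S A" by (rule End_is_pomonoid)
  show ?thesis
  proof
    show "poset_on (carrier (End_left A)) (lle (End_left A))" using poset_A by simp
  next
    fix t a assume "t \<in> carrier (End_pomonoid S A)" "a \<in> carrier (End_left A)"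
    then show "lact (End_left A) t a \<in> carrier (End_left A)"
      using right_homD(1)[of t S A A a] by simp
  next
    fix s t a b
    assume H: "s \<in> carrier (End_pomonoid S A)" "t \<in> carrier (End_pomonoid S A)"
      "a \<in> carrier (End_left A)" "b \<in> carrier (End_left A)"
      "mle (End_pomonoid S A) s t" "lle (End_left A) a b"
    then have s: "s \<in> right_hom S A A" and t: "t \<in> right_hom S A A"
      and ab: "a \<in> carrier A" "b \<in> carrier A" by simp_all
    have "rle A (s a) (s b)" "rle A (s b) (t b)"
      using H(5,6) ab right_homD(2)[OF s ab] by simp_all
    then have "rle A (s a) (t b)"
      using poset_onD(2)[OF poset_A] right_homD(1)[OF s ab(1)] right_homD(1)[OF s ab(2)]
        right_homD(1)[OF t ab(2)] by blast
    then show "lle (End_left A) (lact (End_left A) s a) (lact (End_left A) t b)" by simp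
  qed (simp_all add: compose_eq)
qed

end

section \<open>The generator property\<close>

context coordinatized
begin

text \<open>The orbit map of \<open>d\<close> precomposed with \<sigma>. Since to_End(t b) = t for
  every endomorphism t, evaluation at \<open>b\<close> is a section of \<open>to_End\<close>: End(B)
  is a retract of \<open>B\<close> as a left End(B)-poset.\<close>

definition to_End :: "'b \<Rightarrow> 'b \<Rightarrow> 'b" where
  "to_End d = (\<lambda>c\<in>carrier B. ract B d (\<sigma> c))"

lemma to_End_hom: "d \<in> carrier B \<Longrightarrow> to_End d \<in> right_hom S B B"
  unfolding to_End_def by (rule orbit_hom[OF _ \<sigma> right_sposet_B])

lemma to_End_base: "to_End b = (\<lambda>c\<in>carrier B. c)"
  by (simp add: to_End_def coord cong: restrict_cong)

text \<open>An endomorphism commutes with the action of S, so t(d) \<sigma>(c) = t(d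
  \<sigma>(c)).\<close>

lemma to_End_act:
  assumes "t \<in> right_hom S B B" "d \<in> carrier B"
  shows "to_End (t d) = compose (carrier B) t (to_End d)"
  using right_homD(1)[OF assms] right_homD(3)[OF assms] coord_closed
  by (auto simp: to_End_def compose_def fun_eq_iff)

lemma to_End_mono:
  assumes "d \<in> carrier B" "d' \<in> carrier B" "rle B d d'" "c \<in> carrier B"
  shows "rle B (to_End d c) (to_End d' c)"
  using assms coord_closed poset_onD(1)[OF poset] by (simp add: to_End_def ract_mono)

lemma left_generator_B: "left_generator TYPE('v) (End_pomonoid S B) (End_left B)"
  unfolding left_generator_def
proof (intro conjI allI impI)
  show "left_tposet (End_pomonoid S B) (End_left B)" by (rule End_left_is_left_tposet)
  fix X Y :: "('v, 'b \<Rightarrow> 'b) left_poset" and \<alpha> \<beta>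
  let ?T = "End_pomonoid S B"
  assume X: "left_tposet ?T X" and "left_tposet ?T Y"
    and \<alpha>: "\<alpha> \<in> left_hom ?T X Y" and \<beta>: "\<beta> \<in> left_hom ?T X Y" and "\<alpha> \<noteq> \<beta>"
  interpret X: left_tposet ?T X by fact
  \<comment> \<open>Distinct extensional maps already differ at a point of the carrier.\<close>
  obtain x where x: "x \<in> carrier X" "\<alpha> x \<noteq> \<beta> x"
    using \<open>\<alpha> \<noteq> \<beta>\<close> extensionalityI[OF left_homD(2)[OF \<alpha>] left_homD(2)[OF \<beta>]] by blast
  \<comment> \<open>The orbit map of \<open>x\<close> from End(B) to \<open>X\<close>, precomposed
    with \<open>to_End\<close>; it sends \<open>b\<close> to \<open>x\<close> because
    \<open>to_End b\<close> is the identity.\<close>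
  let ?g = "\<lambda>d\<in>carrier B. lact X (to_End d) x"
  have "?g \<in> left_hom ?T (End_left B) X"
    unfolding left_hom_def
  proof (intro CollectI conjI ballI impI)
    fix d d' assume "d \<in> carrier (End_left B)" "d' \<in> carrier (End_left B)"
      "lle (End_left B) d d'"
    \<comment> \<open>The pointwise bound from \<open>to_End_mono\<close> is exactly the order of
      End(B), so monotonicity of the action on \<open>X\<close> applies.\<close>
    then show "lle X (?g d) (?g d')"
      using x(1) to_End_hom to_End_mono poset_onD(1)[OF X.poset_A]
      by (auto intro!: X.lact_mono)
  next
    fix t d assume H: "t \<in> carrier ?T" "d \<in> carrier (End_left B)"
    then have "t d \<in> carrier B" using right_homD(1)[of t S B B d] by simp
    with H show "?g (lact (End_left B) t d) = lact X t (?g d)"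
      using x(1) X.lact_mult[of t "to_End d" x] to_End_hom
      by (simp add: to_End_act)
  qed (use x(1) to_End_hom X.lact_closed in auto)
  moreover have "?g b = x"
    using b x(1) X.lact_one by (simp add: to_End_base)
  then have "compose (carrier (End_left B)) \<alpha> ?g b \<noteq> compose (carrier (End_left B)) \<beta> ?g b"
    using b x(2) by (simp add: compose_eq)
  ultimately show "\<exists>g\<in>left_hom ?T (End_left B) X.
      compose (carrier (End_left B)) \<alpha> g \<noteq> compose (carrier (End_left B)) \<beta> g"
    by metis
qed

end

theorem theorem3p11:
  fixes S :: "'s pomonoid"
    and A :: "('a, 's) right_poset"
    and B :: "('b, 's) right_poset"
    and f :: "'a \<Rightarrow> 'b"
  assumes "pomonoid S"
    and "right_sposet S A"
    and "right_sposet S B"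
    and "f \<in> right_hom S A B"
    and "slice_emb_injective TYPE('s + 'a + 'b) S A B f"
    and "cyclic S A"
    and "projective TYPE('s + 'a + 'b) S A"
  shows "cyclic S B \<and> projective TYPE('u) S B \<and>
    left_generator TYPE('v) (End_pomonoid S B) (End_left B)"
proof -
  note A = assms(2) and B = assms(3) and f = assms(4)
  interpret B: right_sposet S B by fact
  \<comment> \<open>The sum type has room for copies of S and \<open>A\<close>, used to split the
    cover of \<open>A\<close>, and of \<open>B\<close>, used to split \<open>f\<close>.\<close>
  have inj: "inj (Inl :: 's \<Rightarrow> 's + 'a + 'b)" "inj (\<lambda>a. Inr (Inl a) :: 's + 'a + 'b)"
    "inj (\<lambda>b. Inr (Inr b) :: 's + 'a + 'b)"
    by (auto intro: injI)
  obtain g where g: "g \<in> right_hom S B A" "\<And>b. b \<in> carrier B \<Longrightarrow> f (g b) = b"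
    using slice_emb_injective_section[OF assms(5) inj(3) B] by blast
  obtain a \<tau> where a: "a \<in> carrier A" and \<tau>: "\<tau> \<in> right_hom S A (right_regular S)"
      "\<And>c. c \<in> carrier A \<Longrightarrow> ract A a (\<tau> c) = c"
    using cyclic_projective_coordinate[OF A assms(6,7) inj(1,2)] by blast
  \<comment> \<open>The base point is the image of the generator, and the coordinate of c is that of
    g(c) in \<open>A\<close>: f(a) \<tau>(g c) = f(a \<tau>(g c)) = f(g c) = c.\<close>
  interpret coordinatized S B "f a" "compose (carrier B) \<tau> g"
  proof
    show "f a \<in> carrier B" by (rule right_homD(1)[OF f a])
    show "compose (carrier B) \<tau> g \<in> right_hom S B (right_regular S)"
      by (rule right_hom_compose[OF B g(1) \<tau>(1)])
    fix c assume c: "c \<in> carrier B"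
    note gc = right_homD(1)[OF g(1) c]
    have "ract B (f a) (\<tau> (g c)) = f (ract A a (\<tau> (g c)))"
      using right_homD(3)[OF f a] right_homD(1)[OF \<tau>(1) gc] by simp
    also have "\<dots> = c" using \<tau>(2)[OF gc] g(2)[OF c] by simp
    finally show "ract B (f a) (compose (carrier B) \<tau> g c) = c" using c by (simp add: compose_eq)
  qed
  show ?thesis using cyclic_B projective_B left_generator_B by blast
qed

end
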